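(* For $k=1$ and every real $c<3$, no deterministic online algorithm for the $1$-Canadian Traveller Problem with predictions is $c$-competitive, even when restricted to instances whose prediction error is at most $1$ and whose graph is path-disjoint.
   Context: $k$-Canadian Traveller Problem ($k$-CTP) with predictions: an instance consists of a connected undirected graph $G=(V,E)$, a source $s$, a destination $t$, a nonnegative cost function $c:E\to\mathbb{R}^+$, an unknown set $B\subseteq E$ of blocked edges with $|B|\le k$ such that $G-B$ contains an $s$-$t$ path, and a predicted set $B_p\subseteq E$ of blocked edges with $|B_p|\le k$. The traveller knows $G,c,s,t,k,B_p$ in advance, starts at $s$, and learns whether an edge is blocked only upon reaching one of its endpoints; blocked edges cannot be traversed. $ALG$ is the total cost travelled, $OPT$ the cost of a shortest $s$-$t$ path in $G-B$. A deterministic algorithm is $c$-competitive if $ALG\le c\cdot OPT$ on every instance. The prediction error is $|B\triangle B_p|$. A graph is path-disjoint if all its $s$-$t$ paths are pairwise node-disjoint apart from $s$ and $t$. *)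

theory Defs
  imports Complex_Main "HOL-Library.Extended_Real"
begin

text \<open>Finite simple undirected graphs: an edge is a two-element set of vertices.
  Walks and paths are nonempty vertex lists.\<close>

definition simple_graph :: "'v set \<Rightarrow> 'v set set \<Rightarrow> bool" where
  "simple_graph V E \<longleftrightarrow>
     finite V \<and> E \<subseteq> {{u, v} | u v. u \<in> V \<and> v \<in> V \<and> u \<noteq> v}"

definition is_path :: "'v set \<Rightarrow> 'v set set \<Rightarrow> 'v \<Rightarrow> 'v \<Rightarrow> 'v list \<Rightarrow> bool" where
  "is_path V E u v p \<longleftrightarrow>
     p \<noteq> [] \<and> hd p = u \<and> last p = v \<and> set p \<subseteq> V \<and> distinct p \<and>
     successively (\<lambda>x y. {x, y} \<in> E) p"

definition graph_connected :: "'v set \<Rightarrow> 'v set set \<Rightarrow> bool" where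
  "graph_connected V E \<longleftrightarrow> (\<forall>u\<in>V. \<forall>v\<in>V. \<exists>p. is_path V E u v p)"

fun walk_cost :: "('v set \<Rightarrow> real) \<Rightarrow> 'v list \<Rightarrow> real" where
  "walk_cost w (x # y # xs) = w {x, y} + walk_cost w (y # xs)"
| "walk_cost w _ = 0"

text \<open>The part of an instance that the traveller knows in advance.  Only the values of
  \<open>cost\<close> on \<open>edges\<close> are meaningful.\<close>

record 'v ctp_input =
  verts :: "'v set"
  edges :: "'v set set"
  source :: 'v
  target :: 'v
  cost :: "'v set \<Rightarrow> real"
  budget :: nat
  predicted :: "'v set set"

text \<open>A full instance consists of the known input and the unknown set of blocked edges.\<close>

type_synonym 'v ctp_instance = "'v ctp_input \<times> 'v set set"

definition ctp_instance :: "'v ctp_input \<Rightarrow> 'v set set \<Rightarrow> bool" where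
  "ctp_instance I B \<longleftrightarrow>
     simple_graph (verts I) (edges I) \<and>
     graph_connected (verts I) (edges I) \<and>
     source I \<in> verts I \<and> target I \<in> verts I \<and>
     (\<forall>e\<in>edges I. 0 \<le> cost I e) \<and>
     B \<subseteq> edges I \<and> card B \<le> budget I \<and>
     predicted I \<subseteq> edges I \<and> card (predicted I) \<le> budget I \<and>
     (\<exists>p. is_path (verts I) (edges I - B) (source I) (target I) p)"

definition prediction_error :: "'v ctp_input \<Rightarrow> 'v set set \<Rightarrow> nat" where
  "prediction_error I B = card (sym_diff B (predicted I))"

definition path_disjoint :: "'v ctp_input \<Rightarrow> bool" where
  "path_disjoint I \<longleftrightarrow>
     (\<forall>p q. is_path (verts I) (edges I) (source I) (target I) p \<longrightarrow>
            is_path (verts I) (edges I) (source I) (target I) q \<longrightarrow>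
            p \<noteq> q \<longrightarrow> set p \<inter> set q \<subseteq> {source I, target I})"

definition opt_cost :: "'v ctp_input \<Rightarrow> 'v set set \<Rightarrow> real" where
  "opt_cost I B =
     Min (walk_cost (cost I) `
       {p. is_path (verts I) (edges I - B) (source I) (target I) p})"

text \<open>A deterministic online algorithm computes the next vertex from the input, the walk
  made so far (whose last element is the current position), and the set of blocked edges
  revealed so far.  An edge incident to a visited vertex and not in the latter set is
  thereby known to be unblocked.\<close>

type_synonym 'v ctp_algorithm = "'v ctp_input \<Rightarrow> 'v list \<Rightarrow> 'v set set \<Rightarrow> 'v"

definition revealed :: "'v set set \<Rightarrow> 'v list \<Rightarrow> 'v set set" where
  "revealed B xs = {e \<in> B. e \<inter> set xs \<noteq> {}}"

text \<open>The walk after \<open>n\<close> moves; the traveller stops on reaching the target.\<close>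

fun run :: "'v ctp_algorithm \<Rightarrow> 'v ctp_input \<Rightarrow> 'v set set \<Rightarrow> nat \<Rightarrow> 'v list" where
  "run A I B 0 = [source I]"
| "run A I B (Suc n) =
     (let xs = run A I B n in
      if last xs = target I then xs else xs @ [A I xs (revealed B xs)])"

text \<open>Every move made on an instance of the class goes along an unblocked edge.\<close>

definition online_algorithm_on :: "'v ctp_instance set \<Rightarrow> 'v ctp_algorithm \<Rightarrow> bool" where
  "online_algorithm_on C A \<longleftrightarrow>
     (\<forall>(I, B)\<in>C. \<forall>n. last (run A I B n) \<noteq> target I \<longrightarrow>
        {last (run A I B n), A I (run A I B n) (revealed B (run A I B n))}
          \<in> edges I - B)"

text \<open>The cost of a run that never reaches the target is infinite by convention, even if
  the infinite walk has finite total length.\<close>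

definition alg_cost :: "'v ctp_algorithm \<Rightarrow> 'v ctp_input \<Rightarrow> 'v set set \<Rightarrow> ereal" where
  "alg_cost A I B =
     (if \<exists>n. last (run A I B n) = target I
      then ereal (walk_cost (cost I) (run A I B (LEAST n. last (run A I B n) = target I)))
      else \<infinity>)"

definition competitive_on ::
  "'v ctp_instance set \<Rightarrow> real \<Rightarrow> 'v ctp_algorithm \<Rightarrow> bool" where
  "competitive_on C c A \<longleftrightarrow>
     (\<forall>(I, B)\<in>C. alg_cost A I B \<le> ereal (c * opt_cost I B))"

end

theory Submission
  imports Defs
begin

text \<open>Take two routes \<open>s - 1 - t\<close> and \<open>s - 2 - t\<close> whose first edges cost 1 and whose second edges
  cost 0, with an empty prediction.  Nothing is revealed at \<open>s\<close>, so the first move to some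
  \<open>a \<in> {1, 2}\<close> does not depend on which of the second edges is blocked; the adversary blocks
  \<open>{a, t}\<close>, a prediction error of 1.  The traveller must return to \<open>s\<close> and pays at least 3,
  while the other route costs 1.\<close>

text \<open>The edge inequalities telescope along the walk. The bound covers walks with revisits
  too, so the traveller's later moves need no case analysis.\<close>

lemma walk_cost_ge_potential:
  assumes "\<And>x y. {x, y} \<in> E \<Longrightarrow> \<phi> x \<le> w {x, y} + \<phi> y"
    and "successively (\<lambda>x y. {x, y} \<in> E) p" "p \<noteq> []"
  shows "\<phi> (hd p) - \<phi> (last p) \<le> walk_cost w p"
  using assms(2,3)
proof (induction p rule: induct_list012)
  case (3 x y xs)
  then show ?case
    using assms(1)[of x y] by simp
qed auto

lemma run_not_Nil: "run A I B n \<noteq> []"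
  by (induction n) (auto simp: Let_def)

lemma successively_run:
  assumes "online_algorithm_on C A" "(I, B) \<in> C"
  shows "successively (\<lambda>x y. {x, y} \<in> edges I - B) (run A I B n)"
proof (induction n)
  case (Suc n)
  have "last (run A I B n) \<noteq> target I \<Longrightarrow>
        {last (run A I B n), A I (run A I B n) (revealed B (run A I B n))} \<in> edges I - B"
    using assms unfolding online_algorithm_on_def by blast
  with Suc show ?case
    by (auto simp: Let_def successively_append_iff run_not_Nil)
qed auto

text \<open>Later moves only append, so the first move stays visible in every longer run; it depends
  on \<open>B\<close> only through what is revealed at the source.\<close>

lemma run_Suc_eq:
  assumes "source I \<noteq> target I"
  shows "\<exists>xs. run A I B (Suc n) = source I # A I [source I] (revealed B [source I]) # xs"
proof (induction n)
  case (Suc n)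
  then show ?case
    \<comment> \<open>Unfolding a single step keeps \<open>run A I B (Suc n)\<close> intact for the
      induction hypothesis.\<close>
    by (subst run.simps) (auto simp: Let_def simp del: run.simps)
qed (use assms in \<open>auto simp: Let_def\<close>)

lemma is_path_Diff: "is_path V (E - B) u v p \<Longrightarrow> is_path V E u v p"
  unfolding is_path_def by (auto elim: successively_mono)

text \<open>Otherwise simp would turn the vertex \<open>1\<close> into \<open>Suc 0\<close>.\<close>

declare One_nat_def [simp del]

definition diamond_edges :: "nat set set" where
  "diamond_edges = {{0, 1}, {0, 2}, {1, 3}, {2, 3}}"

definition diamond :: "nat ctp_input" where
  "diamond = \<lparr>verts = {0, 1, 2, 3}, edges = diamond_edges, source = 0, target = 3,
     cost = (\<lambda>e. if 0 \<in> e then 1 else 0), budget = 1, predicted = {}\<rparr>"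

lemma diamond_simps [simp]:
  "verts diamond = {0, 1, 2, 3}" "edges diamond = diamond_edges"
  "source diamond = 0" "target diamond = 3"
  "cost diamond = (\<lambda>e. if 0 \<in> e then 1 else 0)"
  "budget diamond = 1" "predicted diamond = {}"
  by (simp_all add: diamond_def)

text \<open>The graph is complete bipartite with parts \<open>{0, 3}\<close> and
  \<open>{1, 2}\<close>; in this form adjacency is decided without comparing two-element
  sets.\<close>

lemma diamond_edge_iff:
  "{x, y} \<in> diamond_edges \<longleftrightarrow> x \<in> {0, 3} \<and> y \<in> {1, 2} \<or> x \<in> {1, 2} \<and> y \<in> {0, 3}"
  by (auto simp: diamond_edges_def doubleton_eq_iff)

lemma diamond_path_iff:
  "is_path {0, 1, 2, 3} diamond_edges 0 3 p \<longleftrightarrow> p = [0, 1, 3] \<or> p = [0, 2, 3]"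
proof
  assume *: "is_path {0, 1, 2, 3} diamond_edges 0 3 p"
  then obtain p' where p: "p = 0 # p'" "p' \<noteq> []"
    by (cases p) (auto simp: is_path_def split: if_splits)
  with * obtain a p'' where p': "p' = a # p''" "p'' \<noteq> []"
    by (cases p') (auto simp: is_path_def diamond_edge_iff split: if_splits)
  with * p obtain p3 where p'': "p'' = 3 # p3"
    by (cases p'') (auto simp: is_path_def diamond_edge_iff)
  with * p p' have "3 \<notin> set p3" "p3 \<noteq> [] \<Longrightarrow> last p3 = 3"
    by (auto simp: is_path_def)
  \<comment> \<open>A nonempty \<open>p3\<close> would end in a second \<open>3\<close>, against
    distinctness.\<close>
  then have "p3 = []"
    using last_in_set by metis
  with * p p' p'' show "p = [0, 1, 3] \<or> p = [0, 2, 3]"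
    by (auto simp: is_path_def diamond_edge_iff)
qed (auto simp: is_path_def diamond_edge_iff)

lemma path_disjoint_diamond: "path_disjoint diamond"
  unfolding path_disjoint_def diamond_simps diamond_path_iff by auto

text \<open>Deleting an edge creates no path, so only the two routes are candidates, and the one
  through \<open>a\<close> needs the blocked edge.\<close>

lemma diamond_path_blocked_iff:
  assumes "(a, b) \<in> {(1, 2), (2, 1)}"
  shows "is_path {0, 1, 2, 3} (diamond_edges - {{a, 3}}) 0 3 p \<longleftrightarrow> p = [0, b, 3]"
proof
  assume *: "is_path {0, 1, 2, 3} (diamond_edges - {{a, 3}}) 0 3 p"
  then have "p = [0, 1, 3] \<or> p = [0, 2, 3]"
    by (simp add: diamond_path_iff [symmetric] is_path_Diff)
  with * assms show "p = [0, b, 3]"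
    by (auto simp: is_path_def)
qed (use assms in \<open>auto simp: is_path_def diamond_edge_iff doubleton_eq_iff\<close>)

lemma graph_connected_diamond: "graph_connected {0, 1, 2, 3} diamond_edges"
proof -
  \<comment> \<open>Distinct non-adjacent vertices lie in the same part, so any vertex of the other
    part links them.\<close>
  have "is_path {0, 1, 2, 3} diamond_edges u v
      (if u = v then [u] else if {u, v} \<in> diamond_edges then [u, v]
       else if u \<in> {0, 3} then [u, 1, v] else [u, 0, v])"
    if "u \<in> {0, 1, 2, 3}" "v \<in> {0, 1, 2, 3}" for u v
    using that by (auto simp: is_path_def diamond_edge_iff)
  then show ?thesis
    unfolding graph_connected_def by blast
qed

lemma simple_graph_diamond: "simple_graph {0, 1, 2, 3} diamond_edges"
proof -
  have "\<exists>u v. e = {u, v} \<and> u \<in> {0, 1, 2, 3} \<and> v \<in> {0, 1, 2, 3} \<and> u \<noteq> v"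
    if "e \<in> diamond_edges" for e
    using that unfolding diamond_edges_def
    by (elim insertE emptyE; intro exI conjI; assumption?) auto
  then show ?thesis
    unfolding simple_graph_def by blast
qed

lemma ctp_instance_diamond:
  assumes "B \<subseteq> diamond_edges" "card B \<le> 1"
    and "is_path {0, 1, 2, 3} (diamond_edges - B) 0 3 p"
  shows "ctp_instance diamond B"
  unfolding ctp_instance_def diamond_simps
  using assms simple_graph_diamond graph_connected_diamond
  by (intro conjI exI[of _ p]) simp_all

theorem theorem10:
  fixes c :: real
  assumes "c < 3"
  shows "\<not> (\<exists>A :: nat ctp_algorithm.
    online_algorithm_on
      {(I, B). ctp_instance I B \<and> budget I = 1 \<and> prediction_error I B \<le> 1 \<and> path_disjoint I} A \<and>
    competitive_on
      {(I, B). ctp_instance I B \<and> budget I = 1 \<and> prediction_error I B \<le> 1 \<and> path_disjoint I} c A)"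
proof
  let ?C = "{(I, B). ctp_instance I B \<and> budget I = 1 \<and> prediction_error I B \<le> 1 \<and> path_disjoint I}
    :: nat ctp_instance set"
  assume "\<exists>A. online_algorithm_on ?C A \<and> competitive_on ?C c A"
  then obtain A where A: "online_algorithm_on ?C A" and comp: "competitive_on ?C c A"
    by blast
  define a where "a = A diamond [0] {}"
  \<comment> \<open>The unblocked instance serves to make the first move legal: it shows that
    \<open>a\<close> is \<open>1\<close> or \<open>2\<close> before \<open>B\<close> is
    chosen.\<close>
  have "ctp_instance diamond {}"
    by (rule ctp_instance_diamond[of _ "[0, 1, 3]"]) (auto simp: diamond_path_iff)
  then have "(diamond, {}) \<in> ?C"
    using path_disjoint_diamond by (auto simp: prediction_error_def)
  from successively_run[OF A this, of "Suc 0"] have "{0, a} \<in> diamond_edges"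
    by (simp add: revealed_def a_def)
  then have "a \<in> {1, 2}"
    by (auto simp: diamond_edge_iff)
  then obtain b :: nat where ab: "(a, b) \<in> {(1, 2), (2, 1)}"
    by auto
  define B where "B = {{a, 3}}"
  note path_iff = diamond_path_blocked_iff[OF ab, folded B_def]
  have "ctp_instance diamond B"
    by (rule ctp_instance_diamond[of _ "[0, b, 3]"])
      (use ab path_iff in \<open>auto simp: B_def diamond_edge_iff\<close>)
  then have inC: "(diamond, B) \<in> ?C"
    using path_disjoint_diamond by (auto simp: prediction_error_def B_def)
  have opt: "opt_cost diamond B = 1"
    using ab by (auto simp: opt_cost_def path_iff)
  have "alg_cost A diamond B \<le> ereal (c * opt_cost diamond B)"
    using comp inC unfolding competitive_on_def by blast
  then have alg: "alg_cost A diamond B \<le> ereal c"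
    by (simp add: opt)
  \<comment> \<open>A finite bound rules out the default cost \<infinity>, so the traveller
    arrives.\<close>
  then have "\<exists>n. last (run A diamond B n) = 3"
    by (auto simp: alg_cost_def split: if_splits)
  then obtain n where last: "last (run A diamond B n) = 3"
    and cost: "walk_cost (cost diamond) (run A diamond B n) \<le> c"
    using alg LeastI_ex[of "\<lambda>n. last (run A diamond B n) = 3"]
    by (auto simp: alg_cost_def split: if_splits)
  from last obtain m where n: "n = Suc m"
    by (cases n) auto
  have "revealed B [0] = {}"
    using ab by (auto simp: revealed_def B_def)
  then obtain xs where xs: "run A diamond B n = 0 # a # xs"
    using run_Suc_eq[of diamond A B m] by (auto simp: n a_def)
  \<comment> \<open>the distance to the target once \<open>{a, 3}\<close> is blocked\<close>
  define \<phi> :: "nat \<Rightarrow> real" where "\<phi> x = (if x = a then 2 else if x = 0 then 1 else 0)" for x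
  \<comment> \<open>Only the step from \<open>a\<close> to \<open>3\<close> would violate the
    inequality, and \<open>B\<close> blocks it.\<close>
  have pot: "\<phi> x \<le> cost diamond {x, y} + \<phi> y" if "{x, y} \<in> diamond_edges - B" for x y
    using that ab by (auto simp: \<phi>_def diamond_edge_iff B_def doubleton_eq_iff)
  \<comment> \<open>The potential is applied from \<open>a\<close>: from \<open>0\<close> it would
    yield only 1, whereas here it yields 2 on top of the 1 paid for the first edge.\<close>
  have "successively (\<lambda>x y. {x, y} \<in> diamond_edges - B) (a # xs)"
    using successively_run[OF A inC, of n] by (auto simp: xs successively_Cons)
  from walk_cost_ge_potential[of "diamond_edges - B" \<phi> "cost diamond", OF pot this]
  have "\<phi> a - \<phi> 3 \<le> walk_cost (cost diamond) (a # xs)"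
    using last by (simp add: xs)
  moreover have "\<phi> a - \<phi> 3 = 2"
    using ab by (auto simp: \<phi>_def)
  ultimately have "3 \<le> walk_cost (cost diamond) (run A diamond B n)"
    by (simp add: xs)
  with cost assms show False
    by simp
qed

end
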